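(* Let $M^2$ be a smooth connected $2$-manifold and let $f:M^2\to S^3_1$ be a CMC-1 face. Then $M^2$ is orientable.
   Context: $\mathbb{R}^4_1$ (metric $-x_0y_0+x_1y_1+x_2y_2+x_3y_3$) is identified with the $2\times 2$ Hermitian matrices by $$(x_0,x_1,x_2,x_3)\leftrightarrow\begin{pmatrix}x_0+x_3&x_1+ix_2\\ x_1-ix_2&x_0-x_3\end{pmatrix},$$ and de Sitter $3$-space is $S^3_1=\{X=X^*:\det X=-1\}=\{ae_3a^*: a\in SL(2,\mathbb{C})\}$, where $X^*={}^t\bar X$ and $e_3=\begin{pmatrix}1&0\\0&-1\end{pmatrix}$. A holomorphic map $F$ from a Riemann surface to $SL(2,\mathbb{C})$ is null if $\det(dF/dz)$ vanishes identically for each local complex coordinate $z$. A $C^\infty$ map $f:M^2\to S^3_1$ is a CMC-1 face if its regular set (the set of points where $f$ is an immersion) is open and dense in $M^2$, and for each $p\in M^2$ there exist a neighborhood $U$ of $p$ (with a complex structure) and a null holomorphic immersion $F:U\to SL(2,\mathbb{C})$ such that $f=Fe_3F^*$ on $U$. $M^2$ is not assumed orientable. *)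

theory Defs
  imports "HOL-Analysis.Analysis"
begin

section \<open>Smooth maps between normed spaces\<close>

text \<open>
  \<open>Ck_on k S f\<close> is used for open \<open>S\<close> only; then it says that \<open>f\<close> is of class \<open>C\<^sup>k\<close> on \<open>S\<close>.
\<close>

primrec Ck_on :: "nat \<Rightarrow> 'a::real_normed_vector set \<Rightarrow> ('a \<Rightarrow> 'b::real_normed_vector) \<Rightarrow> bool" where
  "Ck_on 0 S f \<longleftrightarrow> continuous_on S f"
| "Ck_on (Suc k) S f \<longleftrightarrow> (\<forall>x\<in>S. f differentiable (at x)) \<and>
     (\<forall>v. Ck_on k S (\<lambda>x. frechet_derivative f (at x) v))"

definition smooth_on :: "'a::real_normed_vector set \<Rightarrow> ('a \<Rightarrow> 'b::real_normed_vector) \<Rightarrow> bool" where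
  "smooth_on S f \<longleftrightarrow> (\<forall>k. Ck_on k S f)"

section \<open>Smooth 2-manifolds\<close>

text \<open>
  A chart on the topological space \<open>X\<close> is a pair of a domain and a coordinate map. The model
  space is left open: smooth charts take values in \<open>real ^ 2\<close>, complex coordinates in \<open>complex\<close>.
\<close>

type_synonym ('a, 'b) chart = "'a set \<times> ('a \<Rightarrow> 'b)"

definition is_chart :: "'a topology \<Rightarrow> ('a, 'b::real_normed_vector) chart \<Rightarrow> bool" where
  "is_chart X = (\<lambda>(U, \<phi>). openin X U \<and> open (\<phi> ` U) \<and>
     homeomorphic_map (subtopology X U) (top_of_set (\<phi> ` U)) \<phi>)"

definition chart_inv :: "('a, 'b) chart \<Rightarrow> 'b \<Rightarrow> 'a" where
  "chart_inv = (\<lambda>(U, \<phi>). inv_into U \<phi>)"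

definition transition :: "('a, 'b) chart \<Rightarrow> ('a, 'c) chart \<Rightarrow> 'b \<Rightarrow> 'c" where
  "transition c d = snd d \<circ> chart_inv c"

definition overlap :: "('a, 'b) chart \<Rightarrow> ('a, 'c) chart \<Rightarrow> 'b set" where
  "overlap c d = snd c ` (fst c \<inter> fst d)"

definition smoothly_compatible ::
    "('a, 'b::real_normed_vector) chart \<Rightarrow> ('a, 'c::real_normed_vector) chart \<Rightarrow> bool" where
  "smoothly_compatible c d \<longleftrightarrow>
     smooth_on (overlap c d) (transition c d) \<and> smooth_on (overlap d c) (transition d c)"

text \<open>
  The smooth structure is given by an atlas that is not required to be maximal; the charts of
  the maximal atlas it generates are those satisfying \<open>smooth_chart X A\<close>.
\<close>

definition smooth_atlas :: "'a topology \<Rightarrow> ('a, real ^ 2) chart set \<Rightarrow> bool" where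
  "smooth_atlas X A \<longleftrightarrow> (\<forall>c\<in>A. is_chart X c) \<and> (\<Union>c\<in>A. fst c) = topspace X \<and>
     (\<forall>c\<in>A. \<forall>d\<in>A. smoothly_compatible c d)"

definition smooth_2_manifold :: "'a topology \<Rightarrow> ('a, real ^ 2) chart set \<Rightarrow> bool" where
  "smooth_2_manifold X A \<longleftrightarrow> Hausdorff_space X \<and> second_countable X \<and> smooth_atlas X A"

definition smooth_chart ::
    "'a topology \<Rightarrow> ('a, real ^ 2) chart set \<Rightarrow> ('a, 'b::real_normed_vector) chart \<Rightarrow> bool" where
  "smooth_chart X A c \<longleftrightarrow> is_chart X c \<and> (\<forall>a\<in>A. smoothly_compatible c a)"

definition orientable :: "'a topology \<Rightarrow> ('a, real ^ 2) chart set \<Rightarrow> bool" where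
  "orientable X A \<longleftrightarrow> (\<exists>B :: ('a, real ^ 2) chart set.
     (\<forall>c\<in>B. smooth_chart X A c) \<and> (\<Union>c\<in>B. fst c) = topspace X \<and>
     (\<forall>c\<in>B. \<forall>d\<in>B. \<forall>x\<in>overlap c d.
        det (matrix (frechet_derivative (transition c d) (at x))) > 0))"

definition smooth_map ::
    "('a, real ^ 2) chart set \<Rightarrow> ('a \<Rightarrow> 'b::real_normed_vector) \<Rightarrow> bool" where
  "smooth_map A f \<longleftrightarrow> (\<forall>c\<in>A. smooth_on (snd c ` fst c) (f \<circ> chart_inv c))"

definition immersive_in_chart ::
    "('a, 'b::real_normed_vector) chart \<Rightarrow> ('a \<Rightarrow> 'c::real_normed_vector) \<Rightarrow> 'a \<Rightarrow> bool" where
  "immersive_in_chart c f p \<longleftrightarrow> inj (frechet_derivative (f \<circ> chart_inv c) (at (snd c p)))"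

definition regular_set ::
    "'a topology \<Rightarrow> ('a, real ^ 2) chart set \<Rightarrow> ('a \<Rightarrow> 'b::real_normed_vector) \<Rightarrow> 'a set" where
  "regular_set X A f = {p \<in> topspace X. \<forall>c\<in>A. p \<in> fst c \<longrightarrow> immersive_in_chart c f p}"

section \<open>Complex structures\<close>

definition holomorphically_compatible ::
    "('a, complex) chart \<Rightarrow> ('a, complex) chart \<Rightarrow> bool" where
  "holomorphically_compatible c d \<longleftrightarrow>
     transition c d holomorphic_on overlap c d \<and> transition d c holomorphic_on overlap d c"

text \<open>
  A complex structure on the open set \<open>U\<close> of the manifold has to induce the given smooth
  structure, hence its charts are taken among the \<open>complex\<close>-valued smooth charts.
\<close>

definition complex_structure_on ::
    "'a topology \<Rightarrow> ('a, real ^ 2) chart set \<Rightarrow> 'a set \<Rightarrow> ('a, complex) chart set \<Rightarrow> bool" where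
  "complex_structure_on X A U C \<longleftrightarrow>
     (\<forall>c\<in>C. smooth_chart X A c) \<and> (\<Union>c\<in>C. fst c) = U \<and>
     (\<forall>c\<in>C. \<forall>d\<in>C. holomorphically_compatible c d)"

definition complex_coordinate ::
    "'a topology \<Rightarrow> 'a set \<Rightarrow> ('a, complex) chart set \<Rightarrow> ('a, complex) chart \<Rightarrow> bool" where
  "complex_coordinate X U C c \<longleftrightarrow>
     is_chart X c \<and> fst c \<subseteq> U \<and> (\<forall>d\<in>C. holomorphically_compatible c d)"

section \<open>De Sitter space and CMC-1 faces\<close>

definition conj_transpose :: "complex ^ 'n ^ 'm \<Rightarrow> complex ^ 'm ^ 'n" where
  "conj_transpose M = (\<chi> i j. cnj (M $ j $ i))"

definition e3 :: "complex ^ 2 ^ 2" where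
  "e3 = vector [vector [1, 0], vector [0, -1]]"

definition SL2C :: "(complex ^ 2 ^ 2) set" where
  "SL2C = {a. det a = 1}"

definition de_sitter_3 :: "(complex ^ 2 ^ 2) set" where
  "de_sitter_3 = {M. M = conj_transpose M \<and> det M = -1}"

definition matrix_deriv :: "(complex \<Rightarrow> complex ^ 2 ^ 2) \<Rightarrow> complex \<Rightarrow> complex ^ 2 ^ 2" where
  "matrix_deriv G z = (\<chi> i j. deriv (\<lambda>w. G w $ i $ j) z)"

definition null_holomorphic_immersion ::
    "'a topology \<Rightarrow> 'a set \<Rightarrow> ('a, complex) chart set \<Rightarrow> ('a \<Rightarrow> complex ^ 2 ^ 2) \<Rightarrow> bool" where
  "null_holomorphic_immersion X U C F \<longleftrightarrow>
     (\<forall>q\<in>U. F q \<in> SL2C) \<and>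
     (\<forall>c. complex_coordinate X U C c \<longrightarrow>
        (\<forall>i j. (\<lambda>z. (F \<circ> chart_inv c) z $ i $ j) holomorphic_on snd c ` fst c) \<and>
        (\<forall>q\<in>fst c. immersive_in_chart c F q) \<and>
        (\<forall>z\<in>snd c ` fst c. det (matrix_deriv (F \<circ> chart_inv c) z) = 0))"

text \<open>
  De Sitter space is an embedded submanifold of the space of matrices, so smoothness and
  immersivity of \<open>f\<close> may be expressed for \<open>f\<close> as a matrix-valued map.
\<close>

definition CMC1_face ::
    "'a topology \<Rightarrow> ('a, real ^ 2) chart set \<Rightarrow> ('a \<Rightarrow> complex ^ 2 ^ 2) \<Rightarrow> bool" where
  "CMC1_face X A f \<longleftrightarrow>
     (\<forall>p\<in>topspace X. f p \<in> de_sitter_3) \<and>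
     smooth_map A f \<and>
     openin X (regular_set X A f) \<and>
     X closure_of (regular_set X A f) = topspace X \<and>
     (\<forall>p\<in>topspace X. \<exists>U C F. openin X U \<and> p \<in> U \<and> complex_structure_on X A U C \<and>
        null_holomorphic_immersion X U C F \<and>
        (\<forall>q\<in>U. f q = F q ** e3 ** conj_transpose (F q)))"

end

theory Submission
  imports Defs "HOL-Complex_Analysis.Cauchy_Integral_Formula"
begin

text \<open>
  The complex coordinates \<open>z\<close> in which \<open>f = F e3 F\<^sup>*\<close> for some null holomorphic \<open>F\<close> turn out to be
  mutually compatible with one orientation. Suppose \<open>z\<close> and \<open>w\<close> are two of them, with lifts \<open>F\<close> and
  \<open>G\<close>, and that the transition map reverses orientation at a point. It then does so nearby, and by
  density on a nonempty open set of regular points. There the nullity of \<open>F\<close> and \<open>G\<close> makes both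
  coordinates conformal for \<open>f\<close>, so \<open>w\<close> is an antiholomorphic function of \<open>z\<close>. Hence
  \<open>f\<^sub>z f\<^sup>-\<^sup>1 = F\<^sub>z F\<^sup>-\<^sup>1\<close> is holomorphic and \<open>f\<^bsub>cnj z\<^esub> f\<^sup>-\<^sup>1 = G\<^bsub>cnj z\<^esub> G\<^sup>-\<^sup>1\<close> is antiholomorphic in \<open>z\<close>.
  Comparing the mixed second derivatives of \<open>f\<close>, these two nilpotent 2 by 2 matrices commute, so
  they are linearly dependent and \<open>f\<close> is not an immersion, a contradiction.
\<close>

section \<open>Smooth maps and charts\<close>

lemma Ck_on_Suc_has_derivative:
  "Ck_on (Suc k) S f \<Longrightarrow> x \<in> S \<Longrightarrow> (f has_derivative frechet_derivative f (at x)) (at x)"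
  by (simp add: frechet_derivative_works)

text \<open>On an open set the derivative at a point depends only on nearby values in that set, so
  the induction can pass from the maps to their directional derivatives.\<close>

lemma Ck_on_cong:
  assumes "open S" "\<And>x. x \<in> S \<Longrightarrow> f x = g x" "Ck_on k S f"
  shows "Ck_on k S g"
  using assms(2,3)
proof (induction k arbitrary: f g)
  case 0
  then show ?case by (simp cong: continuous_on_cong)
next
  case (Suc k)
  have *: "(g has_derivative frechet_derivative f (at x)) (at x)" if "x \<in> S" for x
    using Ck_on_Suc_has_derivative[OF Suc.prems(2) that] \<open>open S\<close> that Suc.prems(1)
    by (rule has_derivative_transform_within_open)
  have "Ck_on k S (\<lambda>x. frechet_derivative g (at x) v)" for v
  proof (rule Suc.IH)
    show "frechet_derivative f (at x) v = frechet_derivative g (at x) v" if "x \<in> S" for x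
      by (rule fun_cong[OF frechet_derivative_at[OF *[OF that]]])
    show "Ck_on k S (\<lambda>x. frechet_derivative f (at x) v)"
      using Suc.prems(2) by simp
  qed
  moreover have "\<forall>x\<in>S. g differentiable (at x)"
    using * unfolding differentiable_def by blast
  ultimately show ?case
    by simp
qed

lemma Ck_on_linear_comp:
  assumes "bounded_linear h" "open S" "Ck_on k S f"
  shows "Ck_on k S (\<lambda>x. h (f x))"
  using assms(3)
proof (induction k arbitrary: f)
  case 0
  then show ?case
    using bounded_linear.continuous_on[OF assms(1)] by simp
next
  case (Suc k)
  note * = bounded_linear.has_derivative[OF assms(1) Ck_on_Suc_has_derivative[OF Suc.prems]]
  have "Ck_on k S (\<lambda>x. frechet_derivative (\<lambda>x. h (f x)) (at x) v)" for v
  proof (rule Ck_on_cong[OF assms(2)])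
    show "Ck_on k S (\<lambda>x. h (frechet_derivative f (at x) v))"
      using Suc.prems by (intro Suc.IH) simp
    show "h (frechet_derivative f (at x) v) = frechet_derivative (\<lambda>x. h (f x)) (at x) v"
      if "x \<in> S" for x
      by (rule fun_cong[OF frechet_derivative_at[OF *[OF that]]])
  qed
  moreover have "\<forall>x\<in>S. (\<lambda>x. h (f x)) differentiable (at x)"
    using * unfolding differentiable_def by blast
  ultimately show ?case
    by simp
qed

text \<open>Since \<open>h\<close> is its own derivative, the direction \<open>v\<close> becomes the
  fixed vector \<open>h v\<close>. Directional derivatives of the composition are therefore again
  compositions with \<open>h\<close>, and the induction closes.\<close>

lemma Ck_on_comp_linear:
  assumes "bounded_linear h" "open T" "h ` T \<subseteq> S" "Ck_on k S f"
  shows "Ck_on k T (\<lambda>x. f (h x))"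
  using assms(4)
proof (induction k arbitrary: f)
  case 0
  then show ?case
    using continuous_on_compose2[OF _ linear_continuous_on[OF assms(1)] assms(3)] by simp
next
  case (Suc k)
  have hS: "h x \<in> S" if "x \<in> T" for x
    using that assms(3) by blast
  note * = has_derivative_compose[OF bounded_linear_imp_has_derivative[OF assms(1)]
      Ck_on_Suc_has_derivative[OF Suc.prems hS]]
  have "Ck_on k T (\<lambda>x. frechet_derivative (\<lambda>x. f (h x)) (at x) v)" for v
  proof (rule Ck_on_cong[OF assms(2)])
    show "Ck_on k T (\<lambda>x. frechet_derivative f (at (h x)) (h v))"
      using Suc.prems by (intro Suc.IH) simp
    show "frechet_derivative f (at (h x)) (h v) = frechet_derivative (\<lambda>x. f (h x)) (at x) v"
      if "x \<in> T" for x
      by (rule fun_cong[OF frechet_derivative_at[OF *[OF that]]])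
  qed
  moreover have "\<forall>x\<in>T. (\<lambda>x. f (h x)) differentiable (at x)"
    using * unfolding differentiable_def by blast
  ultimately show ?case
    by simp
qed

lemma smooth_on_imp_differentiable:
  "smooth_on S f \<Longrightarrow> x \<in> S \<Longrightarrow> f differentiable (at x)"
  unfolding smooth_on_def by (metis Ck_on.simps(2))

lemma smooth_on_imp_continuous_frechet_derivative:
  "smooth_on S f \<Longrightarrow> continuous_on S (\<lambda>x. frechet_derivative f (at x) v)"
  unfolding smooth_on_def by (metis Ck_on.simps)

lemma smooth_on_imp_continuous_on: "smooth_on S f \<Longrightarrow> continuous_on S f"
  unfolding smooth_on_def by (metis Ck_on.simps(1))

section \<open>Charts, overlaps and transition maps\<close>

lemma is_chart_openin: "is_chart X c \<Longrightarrow> openin X (fst c)"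
  by (auto simp: is_chart_def split: prod.splits)

lemma is_chart_homeomorphic_map:
  "is_chart X c \<Longrightarrow> homeomorphic_map (subtopology X (fst c)) (top_of_set (snd c ` fst c)) (snd c)"
  by (auto simp: is_chart_def split: prod.splits)

lemma chart_inv_eq:
  assumes "is_chart X c" "p \<in> fst c"
  shows "chart_inv c (snd c p) = p"
proof -
  have "fst c \<subseteq> topspace X"
    using is_chart_openin[OF assms(1)] openin_subset by blast
  then have "inj_on (snd c) (fst c)"
    using homeomorphic_imp_injective_map[OF is_chart_homeomorphic_map[OF assms(1)]]
    by (simp add: inf.absorb2)
  with assms(2) show ?thesis
    by (simp add: chart_inv_def split_beta)
qed

lemma open_chart_image:
  assumes "is_chart X c" "openin X W" "W \<subseteq> fst c"
  shows "open (snd c ` W)"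
proof -
  have "openin (subtopology X (fst c)) W"
    using assms openin_subset_topspace_eq by (simp add: is_chart_openin openin_open_subtopology)
  then have "openin (top_of_set (snd c ` fst c)) (snd c ` W)"
    using homeomorphic_imp_open_map[OF is_chart_homeomorphic_map[OF assms(1)]]
    by (auto simp: open_map_def)
  moreover have "open (snd c ` fst c)"
    using assms(1) by (auto simp: is_chart_def split: prod.splits)
  ultimately show ?thesis
    using openin_open_trans by blast
qed

lemma openin_chart_preimage:
  assumes "is_chart X c" "open N"
  shows "openin X {p \<in> fst c. snd c p \<in> N}"
proof -
  have sub: "fst c \<subseteq> topspace X"
    using is_chart_openin[OF assms(1)] openin_subset by blast
  have "continuous_map (subtopology X (fst c)) euclidean (snd c)"
    using homeomorphic_imp_continuous_map[OF is_chart_homeomorphic_map[OF assms(1)]]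
    by (simp add: continuous_map_in_subtopology)
  then have "openin (subtopology X (fst c)) {p \<in> topspace (subtopology X (fst c)). snd c p \<in> N}"
    using assms(2) openin_continuous_map_preimage by fastforce
  moreover have "{p \<in> topspace (subtopology X (fst c)). snd c p \<in> N} = {p \<in> fst c. snd c p \<in> N}"
    using sub by auto
  ultimately show ?thesis
    using is_chart_openin[OF assms(1)] openin_open_subtopology by metis
qed

lemma open_overlap:
  assumes "is_chart X c" "is_chart X d"
  shows "open (overlap c d)"
  unfolding overlap_def
  by (rule open_chart_image[OF assms(1)]) (auto simp: assms is_chart_openin openin_Int)

lemma transition_apply:
  assumes "is_chart X c" "p \<in> fst c"
  shows "transition c d (snd c p) = snd d p"
  using chart_inv_eq[OF assms] by (simp add: transition_def)

lemma overlapE: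
  assumes "x \<in> overlap c d"
  obtains p where "p \<in> fst c" "p \<in> fst d" "x = snd c p"
  using assms by (auto simp: overlap_def)

text \<open>Differentiating the identity \<open>transition d c \<circ> transition c d = id\<close>
  on the open overlap gives a left inverse of the derivative.\<close>

lemma frechet_derivative_transition_inj:
  assumes c: "is_chart X c" and d: "is_chart X d" and x: "x \<in> overlap c d"
    and diff: "transition c d differentiable (at x)"
      "transition d c differentiable (at (transition c d x))"
  shows "inj (frechet_derivative (transition c d) (at x))"
proof -
  let ?D = "frechet_derivative (transition c d) (at x)"
  let ?E = "frechet_derivative (transition d c) (at (transition c d x))"
  have "((\<lambda>y. transition d c (transition c d y)) has_derivative (\<lambda>v. ?E (?D v))) (at x)"
    using diff unfolding frechet_derivative_works by (rule has_derivative_compose)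
  moreover have "transition d c (transition c d y) = y" if "y \<in> overlap c d" for y
    using that by (elim overlapE) (simp add: transition_apply[OF c] transition_apply[OF d])
  ultimately have "((\<lambda>y. y) has_derivative (\<lambda>v. ?E (?D v))) (at x)"
    using has_derivative_transform_within_open[OF _ open_overlap[OF c d] x] by fastforce
  then have "(\<lambda>v. ?E (?D v)) = (\<lambda>v. v)"
    using has_derivative_unique has_derivative_ident by blast
  then show ?thesis
    by (metis inj_on_inverseI)
qed

text \<open>Both charts are compatible with those of \<open>A\<close> but not by assumption with
  each other, so near each point the transition is factored through a chart \<open>a\<close> of the
  atlas. Continuity of the derivative later makes the Jacobian continuous.\<close>

lemma transition_C1:
  fixes A :: "('a, real ^ 2) chart set"
  assumes A: "smooth_atlas X A" and c: "smooth_chart X A c" and d: "smooth_chart X A d"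
  shows "\<And>x. x \<in> overlap c d \<Longrightarrow> transition c d differentiable (at x)"
    and "continuous_on (overlap c d) (\<lambda>x. frechet_derivative (transition c d) (at x) v)"
proof -
  have ch: "is_chart X c" "is_chart X d"
    using c d by (auto simp: smooth_chart_def)
  have main: "transition c d differentiable (at x) \<and>
      isCont (\<lambda>x. frechet_derivative (transition c d) (at x) v) x" if x: "x \<in> overlap c d" for x
  proof -
    obtain p where p: "p \<in> fst c" "p \<in> fst d" "x = snd c p"
      using overlapE[OF x] .
    have "p \<in> topspace X"
      using is_chart_openin[OF ch(1)] p(1) openin_subset by blast
    then have "p \<in> (\<Union>a\<in>A. fst a)"
      using A by (simp add: smooth_atlas_def)
    then obtain a where a: "a \<in> A" "p \<in> fst a"
      by blast
    have cha: "is_chart X a"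
      using A a by (auto simp: smooth_atlas_def)
    have sm: "smooth_on (overlap c a) (transition c a)" "smooth_on (overlap a d) (transition a d)"
      using c d a by (auto simp: smooth_chart_def smoothly_compatible_def)
    define W where "W = snd c ` (fst c \<inter> fst d \<inter> fst a)"
    have W: "open W"
      unfolding W_def
      by (rule open_chart_image[OF ch(1)]) (auto simp: ch cha is_chart_openin openin_Int)
    have xW: "x \<in> W"
      using p a by (auto simp: W_def)
    have WE: "y \<in> overlap c a" "transition c a y \<in> overlap a d"
      "transition a d (transition c a y) = transition c d y" if "y \<in> W" for y
      using that
      by (auto simp: W_def overlap_def transition_apply[OF cha] transition_apply[OF ch(1)])
    define D where "D y v = frechet_derivative (transition a d) (at (transition c a y))
        (frechet_derivative (transition c a) (at y) v)" for y v
    have der: "(transition c d has_derivative D y) (at y)" if "y \<in> W" for y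
    proof (rule has_derivative_transform_within_open[OF _ W that])
      show "((\<lambda>y. transition a d (transition c a y)) has_derivative D y) (at y)"
        unfolding D_def
        using smooth_on_imp_differentiable[OF sm(1) WE(1)[OF that]]
          smooth_on_imp_differentiable[OF sm(2) WE(2)[OF that]]
        unfolding frechet_derivative_works by (rule has_derivative_compose)
    qed (use WE in auto)
    \<comment> \<open>In \<open>D y v\<close> the direction fed to the outer derivative varies with
      \<open>y\<close>, whereas smoothness gives continuity for fixed directions. Expanding in the
      basis leaves only fixed directions \<open>b\<close>.\<close>
    have D_sum: "D y v = (\<Sum>b\<in>Basis. (frechet_derivative (transition c a) (at y) v \<bullet> b) *\<^sub>R
        frechet_derivative (transition a d) (at (transition c a y)) b)" if "y \<in> W" for y
    proof -
      let ?L = "frechet_derivative (transition a d) (at (transition c a y))"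
      have "linear ?L"
        using smooth_on_imp_differentiable[OF sm(2)] WE[OF that] linear_frechet_derivative by blast
      then show ?thesis
        unfolding D_def by (subst euclidean_representation[symmetric])
          (simp only: linear_sum linear_scale)
    qed
    have "continuous_on W (\<lambda>y. \<Sum>b\<in>Basis. (frechet_derivative (transition c a) (at y) v \<bullet> b) *\<^sub>R
        frechet_derivative (transition a d) (at (transition c a y)) b)"
    proof (intro continuous_intros)
      show "continuous_on W (\<lambda>y. frechet_derivative (transition c a) (at y) v)"
        using smooth_on_imp_continuous_frechet_derivative[OF sm(1)]
        by (rule continuous_on_subset) (use WE in auto)
      have "continuous_on W (transition c a)"
        using smooth_on_imp_continuous_on[OF sm(1)] by (rule continuous_on_subset) (use WE in auto)
      then show "continuous_on W (\<lambda>y. frechet_derivative (transition a d) (at (transition c a y)) b)" for b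
        by (rule continuous_on_compose2[OF smooth_on_imp_continuous_frechet_derivative[OF sm(2)]])
          (use WE in auto)
    qed
    then have "continuous_on W (\<lambda>y. frechet_derivative (transition c d) (at y) v)"
    proof (rule continuous_on_eq)
      fix y assume y: "y \<in> W"
      show "(\<Sum>b\<in>Basis. (frechet_derivative (transition c a) (at y) v \<bullet> b) *\<^sub>R
          frechet_derivative (transition a d) (at (transition c a y)) b) =
        frechet_derivative (transition c d) (at y) v"
        unfolding D_sum[OF y, symmetric] by (rule fun_cong[OF frechet_derivative_at[OF der[OF y]]])
    qed
    then have "isCont (\<lambda>x. frechet_derivative (transition c d) (at x) v) x"
      using W xW by (simp add: continuous_on_eq_continuous_at)
    with der[OF xW] show ?thesis
      unfolding differentiable_def by blast
  qed
  show "\<And>x. x \<in> overlap c d \<Longrightarrow> transition c d differentiable (at x)"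
    using main by blast
  show "continuous_on (overlap c d) (\<lambda>x. frechet_derivative (transition c d) (at x) v)"
    using main by (auto intro!: continuous_at_imp_continuous_on)
qed

text \<open>The regular set is defined through the charts of \<open>A\<close>. The chain rule
  through such a chart carries regularity to every compatible chart, in particular to a complex
  one.\<close>

lemma immersive_in_smooth_chart:
  fixes A :: "('a, real ^ 2) chart set" and f :: "'a \<Rightarrow> 'b::real_normed_vector"
  assumes A: "smooth_atlas X A" and c: "smooth_chart X A c" and f: "smooth_map A f"
    and p: "p \<in> fst c" "p \<in> regular_set X A f"
  shows "(f \<circ> chart_inv c) differentiable (at (snd c p))" "immersive_in_chart c f p"
proof -
  have "p \<in> (\<Union>a\<in>A. fst a)"
    using A p by (simp add: smooth_atlas_def regular_set_def)
  then obtain a where a: "a \<in> A" "p \<in> fst a"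
    by blast
  have ch: "is_chart X a" "is_chart X c"
    using A a c by (auto simp: smooth_atlas_def smooth_chart_def)
  have sm: "smooth_on (overlap c a) (transition c a)" "smooth_on (overlap a c) (transition a c)"
    using c a by (auto simp: smooth_chart_def smoothly_compatible_def)
  have ov: "snd c p \<in> overlap c a" "snd a p \<in> overlap a c"
    using a p by (auto simp: overlap_def)
  have tr: "transition c a (snd c p) = snd a p"
    by (rule transition_apply[OF ch(2) p(1)])
  let ?D = "frechet_derivative (transition c a) (at (snd c p))"
  let ?E = "frechet_derivative (f \<circ> chart_inv a) (at (snd a p))"
  have "inj ?D"
    using frechet_derivative_transition_inj[OF ch(2,1) ov(1)] tr ov
      smooth_on_imp_differentiable[OF sm(1)] smooth_on_imp_differentiable[OF sm(2)] by auto
  moreover have "inj ?E"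
    using p a by (auto simp: regular_set_def immersive_in_chart_def)
  ultimately have inj: "inj (\<lambda>v. ?E (?D v))"
    by (auto simp: inj_def)
  have "(f \<circ> chart_inv a) differentiable (at (snd a p))"
    using f a smooth_on_imp_differentiable unfolding smooth_map_def by blast
  then have E: "((f \<circ> chart_inv a) has_derivative ?E) (at (transition c a (snd c p)))"
    by (simp only: tr frechet_derivative_works)
  have D: "(transition c a has_derivative ?D) (at (snd c p))"
    using smooth_on_imp_differentiable[OF sm(1) ov(1)] by (simp only: frechet_derivative_works)
  have der: "((f \<circ> chart_inv c) has_derivative (\<lambda>v. ?E (?D v))) (at (snd c p))"
    by (rule has_derivative_transform_within_open[OF has_derivative_compose[OF D E]
          open_overlap[OF ch(2,1)] ov(1)])
      (clarsimp simp: overlap_def transition_apply[OF ch(2)] chart_inv_eq[OF ch(1)] chart_inv_eq[OF ch(2)])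
  show "(f \<circ> chart_inv c) differentiable (at (snd c p))"
    using der unfolding differentiable_def by blast
  show "immersive_in_chart c f p"
    unfolding immersive_in_chart_def frechet_derivative_at[OF der, symmetric] by (rule inj)
qed

section \<open>Real-linear maps of the complex plane and 2 by 2 matrices\<close>

lemma real_linear_complex:
  fixes D :: "complex \<Rightarrow> complex"
  assumes "linear D"
  shows "D v = (D 1 - \<i> * D \<i>) / 2 * v + (D 1 + \<i> * D \<i>) / 2 * cnj v"
proof -
  have "v = Re v *\<^sub>R 1 + Im v *\<^sub>R \<i>"
    by (simp add: complex_eq_iff)
  then have "D v = Re v *\<^sub>R D 1 + Im v *\<^sub>R D \<i>"
    using assms by (metis linear_add linear_scale)
  then show ?thesis
    by (simp add: complex_eq_iff field_simps)
qed

lemma wirtinger_unique: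
  fixes a b c d :: complex
  assumes "\<And>v. v * a + cnj v * b = v * c + cnj v * d"
  shows "a = c" "b = d"
proof -
  have "a + b = c + d" "\<i> * (a - b) = \<i> * (c - d)"
    using assms[of 1] assms[of \<i>] by (simp_all add: algebra_simps)
  then show "a = c" "b = d"
    by (auto simp: algebra_simps complex_eq_iff)
qed

text \<open>The determinant of a real-linear \<open>D\<close> in the real basis 1, \<i> of the
  plane; a negative value means that \<open>D\<close> reverses orientation.\<close>

definition jac :: "(complex \<Rightarrow> complex) \<Rightarrow> real" where
  "jac D = Re (D 1) * Im (D \<i>) - Im (D 1) * Re (D \<i>)"

lemma jac_wirtinger:
  "jac (\<lambda>v. a * v + b * cnj v) = (cmod a)\<^sup>2 - (cmod b)\<^sup>2"
  unfolding cmod_power2 by (simp add: jac_def power2_eq_square algebra_simps)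

lemma jac_nonzero:
  assumes "linear D" "inj D"
  shows "jac D \<noteq> 0"
proof
  assume J: "jac D = 0"
  have Deq: "D (Complex s t) = s *\<^sub>R D 1 + t *\<^sub>R D \<i>" for s t
  proof -
    have "Complex s t = s *\<^sub>R 1 + t *\<^sub>R \<i>"
      by (simp add: complex_eq_iff)
    then show ?thesis
      using assms(1) by (metis linear_add linear_scale)
  qed
  have z: "v = 0" if "D v = 0" for v
    using that assms by (metis injD linear_0)
  \<comment> \<open>Up to sign, these vectors are the columns of the adjugate of the real matrix of
    \<open>D\<close>, which \<open>D\<close> annihilates when its determinant is 0.\<close>
  have "Complex (Re (D \<i>)) (- Re (D 1)) = 0" "Complex (Im (D \<i>)) (- Im (D 1)) = 0"
    by (rule z, use J in \<open>simp add: Deq complex_eq_iff jac_def algebra_simps\<close>)+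
  then have "D 1 = 0"
    by (simp add: complex_eq_iff)
  then show False
    using z[of 1] by simp
qed

text \<open>A trace-free Hermitian 2 by 2 matrix of determinant 0 vanishes, so it suffices to choose
  \<open>v\<close> such that \<open>v * trace N\<close> is purely imaginary.\<close>

lemma null_hermitian_span_degenerate:
  fixes N M :: "complex ^ 2 ^ 2"
  assumes N: "det N = 0" and M: "det M = 0" and xy: "x \<noteq> 0" "y \<noteq> 0"
    and M_eq: "\<And>i j. M $ i $ j = x * N $ i $ j + y * cnj (N $ j $ i)"
  obtains v where "v \<noteq> 0" "\<And>i j. v * N $ i $ j + cnj v * cnj (N $ j $ i) = 0"
proof -
  define p q r s where "p = N $ 1 $ 1" and "q = N $ 1 $ 2" and "r = N $ 2 $ 1" and "s = N $ 2 $ 2"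
  note defs = p_def[symmetric] q_def[symmetric] r_def[symmetric] s_def[symmetric]
  have det: "p * s = q * r"
    using N by (simp add: det_2 defs)
  have cdet: "cnj p * cnj s = cnj q * cnj r"
    using det by (metis complex_cnj_mult)
  have "(x * p + y * cnj p) * (x * s + y * cnj s) - (x * q + y * cnj r) * (x * r + y * cnj q) = 0"
    using M by (simp add: det_2 M_eq defs)
  \<comment> \<open>The squared terms carry \<open>det N\<close> and its conjugate, so only the
    mixed term of the determinant survives. Hence the determinant vanishes on the whole span of
    \<open>N\<close> and its conjugate transpose.\<close>
  then have "x * y * (p * cnj s + cnj p * s - q * cnj q - r * cnj r) = 0"
    using det cdet by algebra
  then have B: "p * cnj s + cnj p * s - q * cnj q - r * cnj r = 0"
    using xy by simp
  obtain v where v: "v \<noteq> 0" "v * (p + s) + cnj v * cnj (p + s) = 0"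
  proof (cases "p + s = 0")
    case True
    then show ?thesis using that[of 1] by simp
  next
    case False
    then show ?thesis
      by (intro that[of "\<i> * cnj (p + s)"]) (simp_all flip: complex_cnj_add)
  qed
  define h k where "h = v * p + cnj v * cnj p" and "k = v * q + cnj v * cnj r"
  have k': "cnj k = v * r + cnj v * cnj q"
    by (simp add: k_def)
  have h': "v * s + cnj v * cnj s = - h"
    using v(2) by (simp add: h_def algebra_simps add_eq_0_iff)
  have "h * (v * s + cnj v * cnj s) - k * cnj k = 0"
    using det cdet B unfolding k' unfolding h_def k_def by algebra
  then have hk: "h * h + k * cnj k = 0"
    unfolding h' by algebra
  \<comment> \<open>As \<open>h\<close> is real, \<open>h * h + k * cnj k\<close> is a sum of two
    squared moduli.\<close>
  have "cnj h = h"
    by (simp add: h_def)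
  then have "complex_of_real ((cmod h)\<^sup>2 + (cmod k)\<^sup>2) = 0"
    using hk by (metis complex_norm_square of_real_add)
  then have "(cmod h)\<^sup>2 + (cmod k)\<^sup>2 = 0"
    using of_real_eq_0_iff by blast
  then have "h = 0" "k = 0"
    by (simp_all add: sum_power2_eq_zero_iff)
  then have "v * N $ i $ j + cnj v * cnj (N $ j $ i) = 0" for i j
    using exhaust_2[of i] exhaust_2[of j] h' k' h_def k_def
    by (auto simp: defs)
  with v that show thesis by blast
qed

text \<open>For trace-free 2 by 2 matrices,
  \<open>det (P + Q) = det P + det Q - trace (P ** Q)\<close>. The last trace vanishes because a
  product of commuting nilpotent matrices is nilpotent.\<close>

lemma det_add_commuting_nilpotent:
  fixes P Q :: "complex ^ 2 ^ 2"
  assumes "trace P = 0" "trace Q = 0" "det P = 0" "det Q = 0" and comm: "P ** Q = Q ** P"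
  shows "det (P + Q) = 0"
proof -
  define a b c a' where "a = P $ 1 $ 1" and "b = P $ 1 $ 2" and "c = P $ 2 $ 1" and "a' = P $ 2 $ 2"
  define d e g d' where "d = Q $ 1 $ 1" and "e = Q $ 1 $ 2" and "g = Q $ 2 $ 1" and "d' = Q $ 2 $ 2"
  note defs = a_def[symmetric] b_def[symmetric] c_def[symmetric] a'_def[symmetric]
    d_def[symmetric] e_def[symmetric] g_def[symmetric] d'_def[symmetric]
  have tr: "a' = - a" "d' = - d"
    using assms(1,2) by (auto simp: trace_def sum_2 defs add_eq_0_iff)
  have det: "a * a + b * c = 0" "d * d + e * g = 0"
    using assms(3,4) unfolding det_2 defs tr by algebra+
  have "(P ** Q) $ i $ j = (Q ** P) $ i $ j" for i j
    using comm by simp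
  from this[of 1 1] this[of 1 2] this[of 2 1]
  have cm: "b * g = e * c" "a * e = b * d" "c * d = g * a"
    by (auto simp: matrix_matrix_mult_def sum_2 defs tr algebra_simps)
  \<comment> \<open>By the commutation relations \<open>a * d + b * g\<close> is half the trace of
    \<open>P ** Q\<close>. If \<open>b\<close> vanishes then so does \<open>a\<close>, and the sum
    is 0 directly.\<close>
  have "b * (a * d + b * g) = 0" "c * (a * d + b * g) = 0"
    using det cm by algebra+
  moreover have "a = 0" if "b = 0"
    using that det by simp
  ultimately have "a * d + b * g = 0"
    by auto
  then show ?thesis
    using det cm by (simp add: det_2 defs tr algebra_simps) algebra
qed

section \<open>Conjugate transposes, adjugates and the form \<open>e3\<close>\<close>

lemma conj_transpose_mult:
  fixes A :: "complex ^ 'n ^ 'm" and B :: "complex ^ 'k ^ 'n"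
  shows "conj_transpose (A ** B) = conj_transpose B ** conj_transpose A"
  by (simp add: conj_transpose_def matrix_matrix_mult_def vec_eq_iff mult.commute)

lemma conj_transpose_e3: "conj_transpose e3 = e3"
  by (simp add: conj_transpose_def e3_def vec_eq_iff forall_2)

lemma conj_transpose_conj_transpose: "conj_transpose (conj_transpose A) = A"
  by (simp add: conj_transpose_def vec_eq_iff)

lemma det_conj_transpose: "det (conj_transpose (A :: complex ^ 2 ^ 2)) = cnj (det A)"
  by (simp add: conj_transpose_def det_2)

lemma det_e3: "det e3 = -1"
  by (simp add: e3_def det_2)

text \<open>The adjugate serves as the inverse on \<open>SL2C\<close>; its explicit entries make the
  derivative of the determinant a polynomial identity.\<close>

definition adj2 :: "complex ^ 2 ^ 2 \<Rightarrow> complex ^ 2 ^ 2" where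
  "adj2 A = vector [vector [A $ 2 $ 2, - A $ 1 $ 2], vector [- A $ 2 $ 1, A $ 1 $ 1]]"

lemma adj2_mult: "det A = 1 \<Longrightarrow> A ** adj2 A = mat 1" "det A = 1 \<Longrightarrow> adj2 A ** A = mat 1"
  by (auto simp: adj2_def matrix_matrix_mult_def mat_def vec_eq_iff forall_2 sum_2 det_2 algebra_simps)

text \<open>Two different matrices are allowed because differentiation in \<open>z\<close> acts on
  the left factor alone and differentiation in \<open>cnj z\<close> on the right one alone.\<close>

lemma herm_entry:
  "(A ** e3 ** conj_transpose B) $ i $ j = A $ i $ 1 * cnj (B $ j $ 1) - A $ i $ 2 * cnj (B $ j $ 2)"
  by (simp add: matrix_matrix_mult_def sum_2 e3_def conj_transpose_def)

text \<open>Here \<open>F'\<close> and \<open>K'\<close> stand for \<open>\<partial>F/\<partial>z\<close> and \<open>\<partial>K/\<partial>cnj z\<close>, where \<open>F\<close> is holomorphic and \<open>K\<close>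
  antiholomorphic. With \<open>f = F e3 F\<^sup>* = K e3 K\<^sup>*\<close>, the nilpotent matrices \<open>P = F' F\<^sup>-\<^sup>1\<close> and
  \<open>Q = K' K\<^sup>-\<^sup>1\<close> satisfy \<open>f\<^sub>z = P f\<close> and \<open>f\<^bsub>cnj z\<^esub> = Q f\<close>, and the mixed derivative of \<open>f\<close> is both
  \<open>P Q f\<close> and \<open>Q P f\<close>.\<close>

lemma matrix_mult_add_distrib_right:
  fixes P Q h :: "complex ^ 2 ^ 2"
  shows "(P + Q) ** h = P ** h + Q ** h"
  by (simp add: matrix_matrix_mult_def vec_eq_iff sum_2 algebra_simps)

lemma det_real_part_of_derivative:
  fixes F F' K K' :: "complex ^ 2 ^ 2"
  assumes f: "F ** e3 ** conj_transpose F = K ** e3 ** conj_transpose K"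
    and fz: "F' ** e3 ** conj_transpose F = K ** e3 ** conj_transpose K'"
    and fzz: "F' ** e3 ** conj_transpose F' = K' ** e3 ** conj_transpose K'"
    and det: "det F = 1" "det K = 1" "det F' = 0" "det K' = 0"
    and tr: "trace (F' ** adj2 F) = 0" "trace (K' ** adj2 K) = 0"
  shows "det (F' ** e3 ** conj_transpose F + F ** e3 ** conj_transpose F') = 0"
proof -
  define P Q h where "P = F' ** adj2 F" and "Q = K' ** adj2 K" and "h = F ** e3 ** conj_transpose F"
  have PF: "P ** F = F'"
    unfolding P_def by (simp add: matrix_mul_assoc[symmetric] adj2_mult det)
  have QK: "Q ** K = K'"
    unfolding Q_def by (simp add: matrix_mul_assoc[symmetric] adj2_mult det)
  \<comment> \<open>Adjoints exchange the \<open>z\<close>-derivative and the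
    \<open>cnj z\<close>-derivative of a Hermitian matrix.\<close>
  have fzb: "F ** e3 ** conj_transpose F' = K' ** e3 ** conj_transpose K"
    using arg_cong[OF fz, of conj_transpose]
    by (simp add: conj_transpose_mult conj_transpose_e3 conj_transpose_conj_transpose matrix_mul_assoc)
  have Ph: "P ** h = F' ** e3 ** conj_transpose F"
    by (simp add: h_def matrix_mul_assoc PF)
  have Qh: "Q ** h = F ** e3 ** conj_transpose F'"
    by (simp add: h_def f fzb matrix_mul_assoc QK)
  have "P ** Q ** h = F' ** e3 ** conj_transpose F'"
    using Qh by (simp add: matrix_mul_assoc[symmetric]) (simp add: matrix_mul_assoc PF)
  moreover have "Q ** P ** h = K' ** e3 ** conj_transpose K'"
    using Ph fz by (simp add: matrix_mul_assoc[symmetric]) (simp add: matrix_mul_assoc QK)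
  ultimately have eq: "P ** Q ** h = Q ** P ** h"
    using fzz by simp
  have deth: "det h = -1"
    by (simp add: h_def det_mul det_conj_transpose det_e3 det)
  then have "invertible h"
    by (simp add: invertible_det_nz)
  then obtain h' where "h ** h' = mat 1"
    by (auto simp: invertible_def)
  then have "P ** Q = Q ** P"
    using arg_cong[OF eq, of "\<lambda>B. B ** h'"] by (simp add: matrix_mul_assoc[symmetric])
  then have "det (P + Q) = 0"
    using tr det by (intro det_add_commuting_nilpotent) (auto simp: P_def Q_def det_mul)
  moreover have "F' ** e3 ** conj_transpose F + F ** e3 ** conj_transpose F' = (P + Q) ** h"
    by (simp add: matrix_mult_add_distrib_right Ph Qh)
  ultimately show ?thesis
    by (simp add: det_mul)
qed

section \<open>Derivatives of products of holomorphic and antiholomorphic factors\<close>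

lemma has_derivative_mult_cnj:
  assumes "a holomorphic_on S" "b holomorphic_on S" "open S" "z \<in> S"
  shows "((\<lambda>z. a z * cnj (b z)) has_derivative
    (\<lambda>v. v * (deriv a z * cnj (b z)) + cnj v * (a z * cnj (deriv b z)))) (at z)"
proof -
  have "(a has_derivative (*) (deriv a z)) (at z)" "(b has_derivative (*) (deriv b z)) (at z)"
    using assms holomorphic_derivI has_field_derivative_imp_has_derivative by blast+
  then show ?thesis
    by (auto intro!: derivative_eq_intros simp: algebra_simps)
qed

text \<open>Keeping \<open>A\<close> and \<open>B\<close> independent allows a second application
  with \<open>A\<close> a derivative, which yields the mixed second derivative.\<close>

lemma has_derivative_herm_entry:
  fixes A B :: "complex \<Rightarrow> complex ^ 2 ^ 2"
  assumes "\<And>i j. (\<lambda>z. A z $ i $ j) holomorphic_on S" "\<And>i j. (\<lambda>z. B z $ i $ j) holomorphic_on S"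
    and "open S" "z \<in> S"
  shows "((\<lambda>z. (A z ** e3 ** conj_transpose (B z)) $ i $ j) has_derivative
    (\<lambda>v. v * (matrix_deriv A z ** e3 ** conj_transpose (B z)) $ i $ j
       + cnj v * (A z ** e3 ** conj_transpose (matrix_deriv B z)) $ i $ j)) (at z)"
  unfolding herm_entry
  by (rule has_derivative_eq_rhs[OF has_derivative_diff[OF
      has_derivative_mult_cnj[OF assms(1,2,3,4)] has_derivative_mult_cnj[OF assms(1,2,3,4)]]])
    (auto simp: matrix_deriv_def algebra_simps)

text \<open>By Jacobi's formula the trace is the derivative of \<open>det (F z)\<close>, which is
  constant on \<open>S\<close>.\<close>

lemma trace_matrix_deriv_adj2:
  assumes F: "\<And>i j. (\<lambda>z. F z $ i $ j) holomorphic_on S" and S: "open S" "z \<in> S"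
    and det: "\<And>z. z \<in> S \<Longrightarrow> det (F z) = 1"
  shows "trace (matrix_deriv F z ** adj2 (F z)) = 0"
proof -
  have d: "((\<lambda>z. F z $ i $ j) has_field_derivative matrix_deriv F z $ i $ j) (at z)" for i j
    unfolding matrix_deriv_def using holomorphic_derivI[OF F S] by simp
  have "((\<lambda>z. det (F z)) has_field_derivative trace (matrix_deriv F z ** adj2 (F z))) (at z)"
    unfolding det_2
    by (rule DERIV_cong[OF DERIV_diff[OF DERIV_mult[OF d d] DERIV_mult[OF d d]]])
      (simp add: trace_def adj2_def matrix_matrix_mult_def sum_2 algebra_simps)
  moreover have "((\<lambda>z. det (F z)) has_field_derivative 0) (at z)"
    by (rule has_field_derivative_transform_within_open[OF DERIV_const[of 1] S]) (simp add: det)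
  ultimately show ?thesis
    using DERIV_unique by blast
qed

section \<open>Two lifts of the same map\<close>

lemma herm_entry_swap:
  "cnj ((A ** e3 ** conj_transpose B) $ i $ j) = (B ** e3 ** conj_transpose A) $ j $ i"
  by (simp add: herm_entry algebra_simps)

text \<open>Conjugation without transposition turns an antiholomorphic matrix function into a
  holomorphic one.\<close>

definition cnj_matrix :: "complex ^ 'n ^ 'm \<Rightarrow> complex ^ 'n ^ 'm" where
  "cnj_matrix A = (\<chi> i j. cnj (A $ i $ j))"

text \<open>Conjugating a Hermitian matrix transposes it, hence the exchanged indices; for distinct
  factors these are exchanged as well.\<close>

lemma cnj_matrix_herm:
  "(cnj_matrix A ** e3 ** conj_transpose (cnj_matrix B)) $ i $ j = (B ** e3 ** conj_transpose A) $ j $ i"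
  by (simp add: herm_entry cnj_matrix_def algebra_simps)

lemma det_cnj_matrix: "det (cnj_matrix (A :: complex ^ 2 ^ 2)) = cnj (det A)"
  by (simp add: cnj_matrix_def det_2)

lemma trace_cnj_matrix_adj2:
  "trace (cnj_matrix A ** adj2 (cnj_matrix B)) = cnj (trace (A ** adj2 B))"
  by (simp add: cnj_matrix_def trace_def adj2_def matrix_matrix_mult_def sum_2)

text \<open>The derivative of a Hermitian matrix-valued map is \<open>v \<mapsto> v N + cnj v N\<^sup>*\<close>, where \<open>N\<close> is its
  \<open>z\<close>-derivative.\<close>

definition hermitian_immersive :: "complex ^ 2 ^ 2 \<Rightarrow> bool" where
  "hermitian_immersive N \<longleftrightarrow>
     (\<forall>v. (\<forall>i j. v * N $ i $ j + cnj v * cnj (N $ j $ i) = 0) \<longrightarrow> v = 0)"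

lemma wirtinger_derivatives_unique:
  fixes g h :: "complex \<Rightarrow> complex"
  assumes "(g has_derivative (\<lambda>v. v * a + cnj v * b)) (at z)"
    and "(h has_derivative (\<lambda>v. v * c + cnj v * d)) (at z)"
    and "open S" "z \<in> S" "\<And>y. y \<in> S \<Longrightarrow> g y = h y"
  shows "a = c" "b = d"
proof -
  have "(h has_derivative (\<lambda>v. v * a + cnj v * b)) (at z)"
    using assms(1,3,4,5) by (rule has_derivative_transform_within_open)
  then have "(\<lambda>v. v * a + cnj v * b) = (\<lambda>v. v * c + cnj v * d)"
    using assms(2) by (rule has_derivative_unique)
  then have *: "v * a + cnj v * b = v * c + cnj v * d" for v
    by (rule fun_cong)
  show "a = c" "b = d"
    using wirtinger_unique[OF *] by auto
qed

text \<open>With \<open>\<alpha>\<close>, \<open>\<beta>\<close> the Wirtinger coefficients of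
  \<open>T\<close>, the chain rule expresses the \<open>z\<close>-derivative \<open>M\<close> as
  \<alpha> times \<open>N\<close> plus \<open>cnj \<beta>\<close> times the adjoint of
  \<open>N\<close>. Both \<open>M\<close> and \<open>N\<close> are singular, so two nonzero
  coefficients would give the derivative a kernel. The negative Jacobian makes \<beta> nonzero, so
  \<alpha> is 0.\<close>

lemma orientation_reversing_antiholomorphic:
  fixes F G :: "complex \<Rightarrow> complex ^ 2 ^ 2" and T :: "complex \<Rightarrow> complex"
  assumes S: "open S" "z \<in> S"
    and F: "\<And>i j. (\<lambda>z. F z $ i $ j) holomorphic_on S" "det (matrix_deriv F z) = 0"
    and R: "open R" "T z \<in> R"
    and G: "\<And>i j. (\<lambda>z. G z $ i $ j) holomorphic_on R" "det (matrix_deriv G (T z)) = 0"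
    and eq: "\<And>z. z \<in> S \<Longrightarrow>
      F z ** e3 ** conj_transpose (F z) = G (T z) ** e3 ** conj_transpose (G (T z))"
    and T: "T differentiable (at z)" "jac (frechet_derivative T (at z)) < 0"
    and imm: "hermitian_immersive (matrix_deriv G (T z) ** e3 ** conj_transpose (G (T z)))"
  obtains \<beta> where "(T has_derivative (\<lambda>v. \<beta> * cnj v)) (at z)"
proof -
  let ?D = "frechet_derivative T (at z)"
  define \<alpha> \<beta> where "\<alpha> = (?D 1 - \<i> * ?D \<i>) / 2" and "\<beta> = (?D 1 + \<i> * ?D \<i>) / 2"
  have D: "?D = (\<lambda>v. \<alpha> * v + \<beta> * cnj v)"
    unfolding \<alpha>_def \<beta>_def
    by (rule ext real_linear_complex linear_frechet_derivative T)+
  have T': "(T has_derivative (\<lambda>v. \<alpha> * v + \<beta> * cnj v)) (at z)"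
    using T(1) unfolding frechet_derivative_works D .
  have J: "(cmod \<alpha>)\<^sup>2 < (cmod \<beta>)\<^sup>2"
    using T(2) by (simp add: D jac_wirtinger)
  then have \<beta>: "\<beta> \<noteq> 0"
    by auto
  define M N where "M = matrix_deriv F z ** e3 ** conj_transpose (F z)"
    and "N = matrix_deriv G (T z) ** e3 ** conj_transpose (G (T z))"
  have MN: "M $ i $ j = \<alpha> * N $ i $ j + cnj \<beta> * cnj (N $ j $ i)" for i j
  proof (rule wirtinger_derivatives_unique(1)[OF _ _ S])
    show "((\<lambda>z. (F z ** e3 ** conj_transpose (F z)) $ i $ j) has_derivative
        (\<lambda>v. v * M $ i $ j + cnj v * cnj (M $ j $ i))) (at z)"
      unfolding M_def herm_entry_swap
      by (rule has_derivative_herm_entry[OF F(1) F(1) S])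
    have "((\<lambda>z. (G z ** e3 ** conj_transpose (G z)) $ i $ j) has_derivative
        (\<lambda>v. v * N $ i $ j + cnj v * cnj (N $ j $ i))) (at (T z))"
      unfolding N_def herm_entry_swap
      by (rule has_derivative_herm_entry[OF G(1) G(1) R])
    from has_derivative_compose[OF T' this]
    show "((\<lambda>z. (G (T z) ** e3 ** conj_transpose (G (T z))) $ i $ j) has_derivative
        (\<lambda>v. v * (\<alpha> * N $ i $ j + cnj \<beta> * cnj (N $ j $ i))
          + cnj v * (\<beta> * N $ i $ j + cnj \<alpha> * cnj (N $ j $ i)))) (at z)"
      by (rule has_derivative_eq_rhs) (simp add: algebra_simps fun_eq_iff)
  qed (simp add: eq)
  have "\<alpha> = 0"
  proof (rule ccontr)
    assume \<alpha>: "\<alpha> \<noteq> 0"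
    have det: "det N = 0" "det M = 0" and cnj_\<beta>: "cnj \<beta> \<noteq> 0"
      by (simp_all add: M_def N_def det_mul F G \<beta>)
    obtain v where "v \<noteq> 0" "\<And>i j. v * N $ i $ j + cnj v * cnj (N $ j $ i) = 0"
      using null_hermitian_span_degenerate[OF det \<alpha> cnj_\<beta> MN] by blast
    then show False
      using imm unfolding hermitian_immersive_def N_def by blast
  qed
  with T' that[of \<beta>] show thesis
    by simp
qed

text \<open>Immersivity in the coordinate of \<open>G\<close> forces \<open>T\<close> to be
  antiholomorphic on all of \<open>S\<close>, so the two representations can be differentiated
  twice. The outcome contradicts immersivity in the coordinate of \<open>F\<close> at any one point
  of \<open>S\<close>.\<close>

lemma not_orientation_reversing:
  fixes F G :: "complex \<Rightarrow> complex ^ 2 ^ 2" and T :: "complex \<Rightarrow> complex"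
  assumes S: "open S" "S \<noteq> {}"
    and F: "\<And>i j. (\<lambda>z. F z $ i $ j) holomorphic_on S"
      "\<And>z. z \<in> S \<Longrightarrow> det (F z) = 1" "\<And>z. z \<in> S \<Longrightarrow> det (matrix_deriv F z) = 0"
    and R: "open R" "\<And>z. z \<in> S \<Longrightarrow> T z \<in> R"
    and G: "\<And>i j. (\<lambda>z. G z $ i $ j) holomorphic_on R"
      "\<And>z. z \<in> R \<Longrightarrow> det (G z) = 1" "\<And>z. z \<in> R \<Longrightarrow> det (matrix_deriv G z) = 0"
    and eq: "\<And>z. z \<in> S \<Longrightarrow>
      F z ** e3 ** conj_transpose (F z) = G (T z) ** e3 ** conj_transpose (G (T z))"
    and T: "\<And>z. z \<in> S \<Longrightarrow> T differentiable (at z)"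
      "\<And>z. z \<in> S \<Longrightarrow> jac (frechet_derivative T (at z)) < 0"
    and immF: "\<And>z. z \<in> S \<Longrightarrow>
      hermitian_immersive (matrix_deriv F z ** e3 ** conj_transpose (F z))"
    and immG: "\<And>z. z \<in> S \<Longrightarrow>
      hermitian_immersive (matrix_deriv G (T z) ** e3 ** conj_transpose (G (T z)))"
  shows False
proof -
  have "\<exists>\<beta>. (T has_derivative (\<lambda>v. \<beta> * cnj v)) (at z)" if z: "z \<in> S" for z
    by (rule orientation_reversing_antiholomorphic[OF S(1) z F(1) F(3)[OF z] R(1) R(2)[OF z]
          G(1) G(3)[OF R(2)[OF z]] eq T(1)[OF z] T(2)[OF z] immG[OF z]]) blast+
  then obtain \<beta> where \<beta>: "\<And>z. z \<in> S \<Longrightarrow> (T has_derivative (\<lambda>v. \<beta> z * cnj v)) (at z)"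
    by metis
  \<comment> \<open>\<open>G\<close> composed with the antiholomorphic \<open>T\<close> is
    antiholomorphic, so its conjugate is holomorphic; it represents the transpose of the same
    Hermitian matrix.\<close>
  define L where "L z = cnj_matrix (G (T z))" for z
  have L': "((\<lambda>z. L z $ i $ j) has_field_derivative cnj (\<beta> z * matrix_deriv G (T z) $ i $ j)) (at z)"
    if z: "z \<in> S" for z i j
  proof -
    have "((\<lambda>w. G w $ i $ j) has_derivative (*) (matrix_deriv G (T z) $ i $ j)) (at (T z))"
      unfolding matrix_deriv_def
      using holomorphic_derivI[OF G(1) R(1) R(2)[OF z]]
      by (simp add: has_field_derivative_imp_has_derivative)
    from has_derivative_cnj[OF has_derivative_compose[OF \<beta>[OF z] this]]
    have "((\<lambda>z. L z $ i $ j) has_derivative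
        (\<lambda>v. cnj (matrix_deriv G (T z) $ i $ j * (\<beta> z * cnj v)))) (at z)"
      by (simp add: L_def cnj_matrix_def)
    then show ?thesis
      unfolding has_field_derivative_def
      by (rule has_derivative_eq_rhs) (simp add: fun_eq_iff algebra_simps)
  qed
  have L_hol: "(\<lambda>z. L z $ i $ j) holomorphic_on S" for i j
    using L' S(1) by (auto simp: holomorphic_on_open)
  have F'_hol: "(\<lambda>z. matrix_deriv F z $ i $ j) holomorphic_on S" for i j
    using holomorphic_deriv[OF F(1) S(1)] by (simp add: matrix_deriv_def)
  have L'_hol: "(\<lambda>z. matrix_deriv L z $ i $ j) holomorphic_on S" for i j
    using holomorphic_deriv[OF L_hol S(1)] by (simp add: matrix_deriv_def)
  have det_L: "det (L z) = 1" if "z \<in> S" for z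
    using that by (simp add: L_def det_cnj_matrix G R)
  have det_L': "det (matrix_deriv L z) = 0" if z: "z \<in> S" for z
  proof -
    have "matrix_deriv L z $ i $ j = cnj (\<beta> z * matrix_deriv G (T z) $ i $ j)" for i j
      using DERIV_imp_deriv[OF L'[OF z]] by (simp add: matrix_deriv_def)
    then have "det (matrix_deriv L z) = cnj ((\<beta> z)\<^sup>2 * det (matrix_deriv G (T z)))"
      by (simp add: det_2 power2_eq_square algebra_simps)
    also have "\<dots> = 0"
      using z by (simp add: G R)
    finally show ?thesis .
  qed
  have eq0: "(F z ** e3 ** conj_transpose (F z)) $ i $ j = (L z ** e3 ** conj_transpose (L z)) $ j $ i"
    if "z \<in> S" for z i j
    unfolding eq[OF that] L_def cnj_matrix_herm ..
  have eq1: "(matrix_deriv F z ** e3 ** conj_transpose (F z)) $ i $ j =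
      (matrix_deriv L z ** e3 ** conj_transpose (L z)) $ j $ i"
    if z: "z \<in> S" for z i j
    by (rule wirtinger_derivatives_unique(1)[OF has_derivative_herm_entry[OF F(1) F(1) S(1) z]
          has_derivative_herm_entry[OF L_hol L_hol S(1) z] S(1) z eq0])
  \<comment> \<open>The identity of \<open>z\<close>-derivatives is differentiated once more, this
    time in \<open>cnj z\<close>.\<close>
  have eq2: "(matrix_deriv F z ** e3 ** conj_transpose (matrix_deriv F z)) $ i $ j =
      (matrix_deriv L z ** e3 ** conj_transpose (matrix_deriv L z)) $ j $ i"
    if z: "z \<in> S" for z i j
    by (rule wirtinger_derivatives_unique(2)[OF has_derivative_herm_entry[OF F'_hol F(1) S(1) z]
          has_derivative_herm_entry[OF L'_hol L_hol S(1) z] S(1) z eq1])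
  obtain z where z: "z \<in> S"
    using S by blast
  define M where "M = matrix_deriv F z ** e3 ** conj_transpose (F z)"
  \<comment> \<open>The matrix is the sum of the \<open>z\<close>- and
    \<open>cnj z\<close>-derivatives, that is, the derivative in the real direction 1. In the lemma
    applied here \<open>K\<close> is \<open>G (T z)\<close>, recovered by conjugating
    \<open>L z\<close>, and \<open>K'\<close> is its \<open>cnj z\<close>-derivative.\<close>
  have det: "det (M + F z ** e3 ** conj_transpose (matrix_deriv F z)) = 0"
    unfolding M_def
  proof (rule det_real_part_of_derivative)
    show "F z ** e3 ** conj_transpose (F z) =
        cnj_matrix (L z) ** e3 ** conj_transpose (cnj_matrix (L z))"
      "matrix_deriv F z ** e3 ** conj_transpose (F z) =
        cnj_matrix (L z) ** e3 ** conj_transpose (cnj_matrix (matrix_deriv L z))"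
      "matrix_deriv F z ** e3 ** conj_transpose (matrix_deriv F z) =
        cnj_matrix (matrix_deriv L z) ** e3 ** conj_transpose (cnj_matrix (matrix_deriv L z))"
      by (simp_all only: vec_eq_iff cnj_matrix_herm eq0[OF z] eq1[OF z] eq2[OF z] simp_thms)
    show "trace (matrix_deriv F z ** adj2 (F z)) = 0"
      by (rule trace_matrix_deriv_adj2[OF F(1) S(1) z F(2)])
    show "trace (cnj_matrix (matrix_deriv L z) ** adj2 (cnj_matrix (L z))) = 0"
      unfolding trace_cnj_matrix_adj2
      using trace_matrix_deriv_adj2[OF L_hol S(1) z det_L] by simp
  qed (simp_all add: det_cnj_matrix det_L det_L' F z)
  \<comment> \<open>Nullity of \<open>M\<close> and singularity of \<open>M\<close> plus its adjoint
    are the degeneracy hypotheses with both coefficients equal to 1.\<close>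
  have "det M = 0"
    by (simp add: M_def det_mul F z)
  moreover have "(M + F z ** e3 ** conj_transpose (matrix_deriv F z)) $ i $ j
      = 1 * M $ i $ j + 1 * cnj (M $ j $ i)" for i j
    by (simp add: M_def herm_entry_swap)
  ultimately obtain v where "v \<noteq> 0" "\<And>i j. v * M $ i $ j + cnj v * cnj (M $ j $ i) = 0"
    using null_hermitian_span_degenerate[OF _ det one_neq_zero one_neq_zero] by blast
  then show False
    using immF[OF z] unfolding hermitian_immersive_def M_def by blast
qed

text \<open>Computing the derivative of \<open>f\<close> in the chart entrywise from the lift puts
  it in Wirtinger form, so its injectivity becomes a condition on the single matrix of
  \<open>z\<close>-derivatives.\<close>

lemma regular_imp_hermitian_immersive:
  fixes A :: "('a, real ^ 2) chart set" and c :: "('a, complex) chart"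
  assumes A: "smooth_atlas X A" and c: "smooth_chart X A c" and f: "smooth_map A f"
    and F: "\<And>i j. (\<lambda>z. (F \<circ> chart_inv c) z $ i $ j) holomorphic_on snd c ` fst c"
    and eq: "\<And>q. q \<in> fst c \<Longrightarrow> f q = F q ** e3 ** conj_transpose (F q)"
    and p: "p \<in> fst c" "p \<in> regular_set X A f"
  shows "hermitian_immersive (matrix_deriv (F \<circ> chart_inv c) (snd c p) ** e3 **
    conj_transpose ((F \<circ> chart_inv c) (snd c p)))"
proof -
  let ?G = "F \<circ> chart_inv c" and ?z = "snd c p"
  let ?D = "frechet_derivative (f \<circ> chart_inv c) (at ?z)"
  define N where "N = matrix_deriv ?G ?z ** e3 ** conj_transpose (?G ?z)"
  have ch: "is_chart X c"
    using c by (simp add: smooth_chart_def)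
  have op: "open (snd c ` fst c)"
    by (rule open_chart_image[OF ch is_chart_openin[OF ch]]) simp
  have zin: "?z \<in> snd c ` fst c"
    using p by blast
  note imm = immersive_in_smooth_chart[OF A c f p]
  have D: "?D v $ i $ j = v * N $ i $ j + cnj v * cnj (N $ j $ i)" for v i j
  proof -
    have bl: "bounded_linear (\<lambda>B :: complex ^ 2 ^ 2. B $ i $ j)"
      by (intro bounded_linear_compose[OF bounded_linear_vec_nth] bounded_linear_vec_nth)
    have 1: "((\<lambda>y. (f \<circ> chart_inv c) y $ i $ j) has_derivative (\<lambda>v. ?D v $ i $ j)) (at ?z)"
      by (rule bounded_linear.has_derivative[OF bl imm(1)[unfolded frechet_derivative_works]])
    have "((\<lambda>z. (?G z ** e3 ** conj_transpose (?G z)) $ i $ j) has_derivative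
        (\<lambda>v. v * N $ i $ j + cnj v * cnj (N $ j $ i))) (at ?z)"
      unfolding N_def herm_entry_swap by (rule has_derivative_herm_entry[OF F F op zin])
    then have "((\<lambda>y. (f \<circ> chart_inv c) y $ i $ j) has_derivative
        (\<lambda>v. v * N $ i $ j + cnj v * cnj (N $ j $ i))) (at ?z)"
      by (rule has_derivative_transform_within_open[OF _ op zin])
        (clarsimp simp: chart_inv_eq[OF ch] eq)
    from fun_cong[OF has_derivative_unique[OF 1 this]] show ?thesis .
  qed
  have "v = 0" if "\<And>i j. v * N $ i $ j + cnj v * cnj (N $ j $ i) = 0" for v
  proof -
    have "?D v = 0"
      by (simp add: vec_eq_iff D that)
    moreover have "?D 0 = 0"
      by (simp add: vec_eq_iff D)
    ultimately show ?thesis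
      using imm(2) unfolding immersive_in_chart_def by (metis injD)
  qed
  then show ?thesis
    unfolding hermitian_immersive_def N_def by blast
qed

section \<open>Complex charts that carry a lift, and their transitions\<close>

text \<open>The charts of all local complex structures are collected together; charts from different
  structures need not be holomorphically compatible a priori.\<close>

definition face_chart ::
    "'a topology \<Rightarrow> ('a, real ^ 2) chart set \<Rightarrow> ('a \<Rightarrow> complex ^ 2 ^ 2) \<Rightarrow> ('a, complex) chart \<Rightarrow> bool" where
  "face_chart X A f c \<longleftrightarrow> (\<exists>U C F. openin X U \<and> complex_structure_on X A U C \<and>
     null_holomorphic_immersion X U C F \<and>
     (\<forall>q\<in>U. f q = F q ** e3 ** conj_transpose (F q)) \<and> c \<in> C)"

lemma face_chartE:
  assumes "face_chart X A f c"
  obtains F where "smooth_chart X A c"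
    "\<And>i j. (\<lambda>z. (F \<circ> chart_inv c) z $ i $ j) holomorphic_on snd c ` fst c"
    "\<And>q. q \<in> fst c \<Longrightarrow> det (F q) = 1"
    "\<And>z. z \<in> snd c ` fst c \<Longrightarrow> det (matrix_deriv (F \<circ> chart_inv c) z) = 0"
    "\<And>q. q \<in> fst c \<Longrightarrow> f q = F q ** e3 ** conj_transpose (F q)"
proof -
  obtain U C F where *: "complex_structure_on X A U C" "null_holomorphic_immersion X U C F"
    "\<forall>q\<in>U. f q = F q ** e3 ** conj_transpose (F q)" "c \<in> C"
    using assms unfolding face_chart_def by blast
  have c: "smooth_chart X A c" and sub: "fst c \<subseteq> U"
    using *(1,4) unfolding complex_structure_on_def by blast+
  \<comment> \<open>A chart of \<open>C\<close> is itself a coordinate of the complex structure, so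
    holomorphy and nullity may be read off in it.\<close>
  have "complex_coordinate X U C c"
    using * c sub by (simp add: complex_coordinate_def complex_structure_on_def smooth_chart_def)
  then have "(\<forall>i j. (\<lambda>z. (F \<circ> chart_inv c) z $ i $ j) holomorphic_on snd c ` fst c) \<and>
      (\<forall>z\<in>snd c ` fst c. det (matrix_deriv (F \<circ> chart_inv c) z) = 0)"
    using *(2) unfolding null_holomorphic_immersion_def by blast
  moreover have "\<forall>q\<in>U. det (F q) = 1"
    using *(2) by (simp add: null_holomorphic_immersion_def SL2C_def)
  ultimately show thesis
    using that[of F] c sub *(3) by blast
qed

text \<open>The Jacobian of a transition is continuous and never 0. A negative value would persist
  on an open set, which meets the dense open regular set in a nonempty open set where the two lifts
  contradict each other.\<close>

lemma face_chart_transition_jac_pos: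
  fixes A :: "('a, real ^ 2) chart set"
  assumes A: "smooth_atlas X A" and f: "smooth_map A f"
    and reg: "openin X (regular_set X A f)" "X closure_of (regular_set X A f) = topspace X"
    and c: "face_chart X A f c" and d: "face_chart X A f d"
    and x: "x \<in> overlap c d"
  shows "jac (frechet_derivative (transition c d) (at x)) > 0"
proof (rule ccontr)
  let ?T = "transition c d"
  let ?J = "\<lambda>y. jac (frechet_derivative ?T (at y))"
  assume "\<not> ?J x > 0"
  obtain F where sc: "smooth_chart X A c"
    and F: "\<And>i j. (\<lambda>z. (F \<circ> chart_inv c) z $ i $ j) holomorphic_on snd c ` fst c"
      "\<And>q. q \<in> fst c \<Longrightarrow> det (F q) = 1"
      "\<And>z. z \<in> snd c ` fst c \<Longrightarrow> det (matrix_deriv (F \<circ> chart_inv c) z) = 0"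
      "\<And>q. q \<in> fst c \<Longrightarrow> f q = F q ** e3 ** conj_transpose (F q)"
    using face_chartE[OF c] by blast
  obtain G where sd: "smooth_chart X A d"
    and G: "\<And>i j. (\<lambda>z. (G \<circ> chart_inv d) z $ i $ j) holomorphic_on snd d ` fst d"
      "\<And>q. q \<in> fst d \<Longrightarrow> det (G q) = 1"
      "\<And>z. z \<in> snd d ` fst d \<Longrightarrow> det (matrix_deriv (G \<circ> chart_inv d) z) = 0"
      "\<And>q. q \<in> fst d \<Longrightarrow> f q = G q ** e3 ** conj_transpose (G q)"
    using face_chartE[OF d] by blast
  have ch: "is_chart X c" "is_chart X d"
    using sc sd by (auto simp: smooth_chart_def)
  note T = transition_C1[OF A sc sd]
  obtain p where p: "p \<in> fst c" "p \<in> fst d" "x = snd c p"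
    by (rule overlapE[OF x])
  have "transition c d x \<in> overlap d c"
    unfolding p(3) transition_apply[OF ch(1) p(1)] using p by (auto simp: overlap_def)
  then have "inj (frechet_derivative ?T (at x))"
    by (intro frechet_derivative_transition_inj[OF ch x] T(1)[OF x] transition_C1(1)[OF A sd sc])
  then have "?J x \<noteq> 0"
    using jac_nonzero linear_frechet_derivative[OF T(1)[OF x]] by blast
  with \<open>\<not> ?J x > 0\<close> have Jx: "?J x < 0"
    by simp
  define N where "N = ?J -` {..<0} \<inter> overlap c d"
  have "continuous_on (overlap c d) ?J"
    unfolding jac_def by (intro continuous_intros T(2))
  then have "open N"
    unfolding N_def continuous_on_open_vimage[OF open_overlap[OF ch]] by simp
  define W where "W = {q \<in> fst c. snd c q \<in> N}"
  have W: "openin X W"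
    unfolding W_def by (rule openin_chart_preimage[OF ch(1) \<open>open N\<close>])
  have pW: "p \<in> W"
    using p x Jx by (simp add: W_def N_def)
  have "p \<in> X closure_of (regular_set X A f)"
    using pW openin_subset[OF W] reg(2) by blast
  \<comment> \<open>Density supplies a regular point in \<open>W\<close>; it makes \<open>S\<close>
    nonempty below.\<close>
  then obtain r where r: "r \<in> regular_set X A f" "r \<in> W"
    using pW W unfolding in_closure_of by blast
  define Q where "Q = W \<inter> regular_set X A f"
  define S where "S = snd c ` Q"
  have Q: "openin X Q" "Q \<subseteq> fst c"
    using openin_Int[OF W reg(1)] by (auto simp: Q_def W_def)
  have QE: "q \<in> fst c" "q \<in> fst d" "q \<in> regular_set X A f" "snd c q \<in> overlap c d" "?J (snd c q) < 0"
    if "q \<in> Q" for q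
  proof -
    show *: "q \<in> fst c" "q \<in> regular_set X A f" "snd c q \<in> overlap c d" "?J (snd c q) < 0"
      using that by (auto simp: Q_def W_def N_def)
    obtain q' where "q' \<in> fst c" "q' \<in> fst d" "snd c q = snd c q'"
      by (rule overlapE[OF *(3)])
    then show "q \<in> fst d"
      using chart_inv_eq[OF ch(1)] *(1) by metis
  qed
  have TQ: "?T (snd c q) = snd d q" if "q \<in> Q" for q
    by (rule transition_apply[OF ch(1) QE(1)[OF that]])
  have Sc: "S \<subseteq> snd c ` fst c"
    using Q(2) by (auto simp: S_def)
  have SE: "\<exists>q\<in>Q. z = snd c q" if "z \<in> S" for z
    using that by (auto simp: S_def)
  show False
  proof (rule not_orientation_reversing)
    show "open S"
      unfolding S_def by (rule open_chart_image[OF ch(1) Q])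
    show "S \<noteq> {}"
      using r by (auto simp: S_def Q_def)
    show "(\<lambda>z. (F \<circ> chart_inv c) z $ i $ j) holomorphic_on S" for i j
      by (rule holomorphic_on_subset[OF F(1) Sc])
    show "open (snd d ` fst d)"
      by (rule open_chart_image[OF ch(2) is_chart_openin[OF ch(2)]]) simp
    show "(\<lambda>z. (G \<circ> chart_inv d) z $ i $ j) holomorphic_on snd d ` fst d" for i j
      by (rule G(1))
    show "det ((G \<circ> chart_inv d) z) = 1" if "z \<in> snd d ` fst d" for z
      using that by (auto simp: chart_inv_eq[OF ch(2)] G(2))
    show "det (matrix_deriv (G \<circ> chart_inv d) z) = 0" if "z \<in> snd d ` fst d" for z
      by (rule G(3)[OF that])
    fix z
    assume z: "z \<in> S"
    then obtain q where q: "q \<in> Q" and zq: "z = snd c q"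
      using SE by blast
    note q' = QE[OF q]
    show "det ((F \<circ> chart_inv c) z) = 1"
      using q' by (simp add: zq chart_inv_eq[OF ch(1)] F(2))
    show "det (matrix_deriv (F \<circ> chart_inv c) z) = 0"
      using z Sc F(3) by blast
    show "?T z \<in> snd d ` fst d"
      using q' by (simp add: zq TQ[OF q])
    show "(F \<circ> chart_inv c) z ** e3 ** conj_transpose ((F \<circ> chart_inv c) z) =
        (G \<circ> chart_inv d) (?T z) ** e3 ** conj_transpose ((G \<circ> chart_inv d) (?T z))"
      unfolding zq TQ[OF q] comp_def chart_inv_eq[OF ch(1) q'(1)] chart_inv_eq[OF ch(2) q'(2)]
        F(4)[OF q'(1), symmetric] G(4)[OF q'(2), symmetric] ..
    show "?T differentiable (at z)" "?J z < 0"
      using T(1)[OF q'(4)] q'(5) zq by blast+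
    show "hermitian_immersive (matrix_deriv (F \<circ> chart_inv c) z ** e3 **
        conj_transpose ((F \<circ> chart_inv c) z))"
      unfolding zq by (rule regular_imp_hermitian_immersive[OF A sc f F(1) F(4) q'(1,3)])
    show "hermitian_immersive (matrix_deriv (G \<circ> chart_inv d) (?T z) ** e3 **
        conj_transpose ((G \<circ> chart_inv d) (?T z)))"
      unfolding zq TQ[OF q] by (rule regular_imp_hermitian_immersive[OF A sd f G(1) G(4) q'(2,3)])
  qed
qed

section \<open>From complex charts to charts in the real plane\<close>

definition plane_of_complex :: "complex \<Rightarrow> real ^ 2" where
  "plane_of_complex z = vector [Re z, Im z]"

definition complex_of_plane :: "real ^ 2 \<Rightarrow> complex" where
  "complex_of_plane v = Complex (v $ 1) (v $ 2)"

lemma plane_complex_inverse [simp]: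
  "complex_of_plane (plane_of_complex z) = z" "plane_of_complex (complex_of_plane v) = v"
  by (simp_all add: plane_of_complex_def complex_of_plane_def vec_eq_iff forall_2 complex_eq_iff)

lemma bounded_linear_plane_of_complex: "bounded_linear plane_of_complex"
  by (intro linear_conv_bounded_linear[THEN iffD1] linearI)
    (simp_all add: plane_of_complex_def vec_eq_iff forall_2)

lemma bounded_linear_complex_of_plane: "bounded_linear complex_of_plane"
  by (intro linear_conv_bounded_linear[THEN iffD1] linearI)
    (simp_all add: complex_of_plane_def complex_eq_iff)

lemma bij_plane_of_complex: "bij plane_of_complex"
  by (rule bij_betw_byWitness[of _ complex_of_plane]) auto

text \<open>The standard basis of the plane corresponds to 1 and \<i>, so the matrix has the
  coordinates of \<open>D 1\<close> and \<open>D \<i>\<close> as columns.\<close>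

lemma det_plane_conjugate:
  "det (matrix (\<lambda>v. plane_of_complex (D (complex_of_plane v)))) = jac D"
proof -
  have "complex_of_plane (axis 1 1) = 1" "complex_of_plane (axis 2 1) = \<i>"
    by (simp_all add: complex_of_plane_def axis_def complex_eq_iff)
  then show ?thesis
    by (simp add: det_2 matrix_def jac_def plane_of_complex_def)
qed

text \<open>Complex structures supply charts into \<open>complex\<close>, whereas
  \<open>orientable\<close> asks for charts into \<open>real ^ 2\<close>.\<close>

definition plane_chart :: "('a, complex) chart \<Rightarrow> ('a, real ^ 2) chart" where
  "plane_chart c = (fst c, plane_of_complex \<circ> snd c)"

lemma fst_plane_chart [simp]: "fst (plane_chart c) = fst c"
  by (simp add: plane_chart_def)

lemma plane_of_complex_eq_iff: "plane_of_complex z = v \<longleftrightarrow> z = complex_of_plane v"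
  by auto

text \<open>This holds at every vector, even off the image of the chart, because both inverses
  choose a point by the same predicate.\<close>

lemma chart_inv_plane_chart: "chart_inv (plane_chart c) = chart_inv c \<circ> complex_of_plane"
  by (simp add: chart_inv_def plane_chart_def inv_into_def fun_eq_iff split_beta plane_of_complex_eq_iff)

lemma transition_from_plane_chart:
  "transition (plane_chart c) d = transition c d \<circ> complex_of_plane"
  by (simp add: transition_def chart_inv_plane_chart comp_assoc)

lemma transition_to_plane_chart:
  "transition d (plane_chart c) = plane_of_complex \<circ> transition d c"
  by (simp add: transition_def plane_chart_def comp_assoc)

lemma overlap_plane_chart:
  "overlap (plane_chart c) d = plane_of_complex ` overlap c d"
  "overlap d (plane_chart c) = overlap d c"
  by (simp_all add: overlap_def image_comp plane_chart_def)

lemma is_chart_plane_chart: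
  assumes "is_chart X c"
  shows "is_chart X (plane_chart c)"
proof -
  let ?S = "snd c ` fst c"
  have "open ?S"
    by (rule open_chart_image[OF assms is_chart_openin[OF assms]]) simp
  have "homeomorphic_maps (top_of_set ?S) (top_of_set (plane_of_complex ` ?S))
      plane_of_complex complex_of_plane"
    unfolding homeomorphic_maps_def
    by (auto simp: linear_continuous_on bounded_linear_plane_of_complex bounded_linear_complex_of_plane)
  then have "homeomorphic_map (top_of_set ?S) (top_of_set (plane_of_complex ` ?S)) plane_of_complex"
    using homeomorphic_map_maps by blast
  from homeomorphic_map_compose[OF is_chart_homeomorphic_map[OF assms] this]
  have "homeomorphic_map (subtopology X (fst c)) (top_of_set ((plane_of_complex \<circ> snd c) ` fst c))
      (plane_of_complex \<circ> snd c)"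
    by (simp add: image_comp)
  moreover have "open ((plane_of_complex \<circ> snd c) ` fst c)"
    using open_bijective_linear_image_eq[of plane_of_complex ?S] \<open>open ?S\<close>
      bounded_linear_plane_of_complex bij_plane_of_complex
    by (simp add: image_comp bounded_linear.linear)
  ultimately show ?thesis
    using is_chart_openin[OF assms] by (simp add: is_chart_def plane_chart_def)
qed

text \<open>Each transition map changes only by a linear isomorphism on one side.\<close>

lemma smooth_chart_plane_chart:
  fixes A :: "('a, real ^ 2) chart set"
  assumes A: "smooth_atlas X A" and c: "smooth_chart X A c"
  shows "smooth_chart X A (plane_chart c)"
proof -
  have ch: "is_chart X c"
    using c by (simp add: smooth_chart_def)
  have "smoothly_compatible (plane_chart c) a" if a: "a \<in> A" for a
  proof -
    have cha: "is_chart X a"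
      using A a by (simp add: smooth_atlas_def)
    have sm: "smooth_on (overlap c a) (transition c a)" "smooth_on (overlap a c) (transition a c)"
      using c a by (auto simp: smooth_chart_def smoothly_compatible_def)
    have "smooth_on (overlap (plane_chart c) a) (transition (plane_chart c) a)"
      unfolding smooth_on_def transition_from_plane_chart comp_def
    proof
      fix k
      show "Ck_on k (overlap (plane_chart c) a) (\<lambda>x. transition c a (complex_of_plane x))"
      proof (rule Ck_on_comp_linear[OF bounded_linear_complex_of_plane])
        show "open (overlap (plane_chart c) a)"
          by (rule open_overlap[OF is_chart_plane_chart[OF ch] cha])
        show "complex_of_plane ` overlap (plane_chart c) a \<subseteq> overlap c a"
          by (auto simp: overlap_plane_chart)
        show "Ck_on k (overlap c a) (transition c a)"
          using sm(1) by (simp add: smooth_on_def)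
      qed
    qed
    moreover have "smooth_on (overlap a (plane_chart c)) (transition a (plane_chart c))"
      unfolding smooth_on_def transition_to_plane_chart comp_def overlap_plane_chart
      using Ck_on_linear_comp[OF bounded_linear_plane_of_complex open_overlap[OF cha ch]] sm(2)
      by (simp add: smooth_on_def)
    ultimately show ?thesis
      by (simp add: smoothly_compatible_def)
  qed
  then show ?thesis
    using is_chart_plane_chart[OF ch] by (simp add: smooth_chart_def)
qed

lemma det_transition_plane_chart:
  assumes "transition c d differentiable (at (complex_of_plane x))"
  shows "det (matrix (frechet_derivative (transition (plane_chart c) (plane_chart d)) (at x))) =
    jac (frechet_derivative (transition c d) (at (complex_of_plane x)))"
proof -
  have "((\<lambda>v. plane_of_complex (transition c d (complex_of_plane v))) has_derivative
      (\<lambda>v. plane_of_complex (frechet_derivative (transition c d) (at (complex_of_plane x))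
        (complex_of_plane v)))) (at x)"
    by (rule bounded_linear.has_derivative[OF bounded_linear_plane_of_complex
          has_derivative_compose[OF bounded_linear_imp_has_derivative[OF bounded_linear_complex_of_plane]
            assms[unfolded frechet_derivative_works]]])
  from frechet_derivative_at[OF this, symmetric] show ?thesis
    by (simp add: transition_from_plane_chart transition_to_plane_chart comp_def det_plane_conjugate)
qed

section \<open>The oriented atlas\<close>

theorem theorem4p1:
  fixes X :: "'a topology"
    and A :: "('a, real ^ 2) chart set"
    and f :: "'a \<Rightarrow> complex ^ 2 ^ 2"
  assumes "smooth_2_manifold X A"
    and "connected_space X"
    and "CMC1_face X A f"
  shows "orientable X A"
proof -
  have A: "smooth_atlas X A"
    using assms(1) by (simp add: smooth_2_manifold_def)
  have f: "smooth_map A f" and reg: "openin X (regular_set X A f)"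
      "X closure_of (regular_set X A f) = topspace X"
    and loc: "\<forall>p\<in>topspace X. \<exists>U C F. openin X U \<and> p \<in> U \<and> complex_structure_on X A U C \<and>
        null_holomorphic_immersion X U C F \<and>
        (\<forall>q\<in>U. f q = F q ** e3 ** conj_transpose (F q))"
    using assms(3) unfolding CMC1_face_def by blast+
  \<comment> \<open>The local lifts provide these charts around every point, and the sign of each
    transition determinant is that of a Jacobian between two lifted complex charts.\<close>
  define B where "B = plane_chart ` {c. face_chart X A f c}"
  have smooth: "smooth_chart X A c" if "face_chart X A f c" for c
    using face_chartE[OF that] by blast
  have cover: "\<exists>c. face_chart X A f c \<and> p \<in> fst c" if p: "p \<in> topspace X" for p
  proof -
    obtain U C F where *: "openin X U" "p \<in> U" "complex_structure_on X A U C"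
        "null_holomorphic_immersion X U C F"
        "\<forall>q\<in>U. f q = F q ** e3 ** conj_transpose (F q)"
      using loc p by blast
    have "p \<in> (\<Union>c\<in>C. fst c)"
      using * by (simp add: complex_structure_on_def)
    then obtain c where "c \<in> C" "p \<in> fst c"
      by blast
    with * show ?thesis
      unfolding face_chart_def by blast
  qed
  show ?thesis
    unfolding orientable_def
  proof (intro exI[of _ B] conjI ballI)
    show "smooth_chart X A b" if "b \<in> B" for b
      using that smooth_chart_plane_chart[OF A smooth] by (auto simp: B_def)
    have "fst c \<subseteq> topspace X" if "face_chart X A f c" for c
      using smooth[OF that] is_chart_openin openin_subset unfolding smooth_chart_def by blast
    moreover have "(\<Union>b\<in>B. fst b) = (\<Union>c\<in>{c. face_chart X A f c}. fst c)"
      by (simp add: B_def)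
    ultimately show "(\<Union>b\<in>B. fst b) = topspace X"
      by (simp only:) (intro subset_antisym UN_least subsetI; use cover in auto)
    fix b b' x
    assume "b \<in> B" "b' \<in> B" and x: "x \<in> overlap b b'"
    then obtain c d where c: "face_chart X A f c" "b = plane_chart c"
      and d: "face_chart X A f d" "b' = plane_chart d"
      by (auto simp: B_def)
    have y: "complex_of_plane x \<in> overlap c d"
      using x by (auto simp: c d overlap_plane_chart)
    show "det (matrix (frechet_derivative (transition b b') (at x))) > 0"
      unfolding c(2) d(2)
      using det_transition_plane_chart[OF transition_C1(1)[OF A smooth[OF c(1)] smooth[OF d(1)] y]]
        face_chart_transition_jac_pos[OF A f reg c(1) d(1) y]
      by simp
  qed
qed

end
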